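(* For every integer $m\ge1$ and every $\epsilon>0$ there is a prophet inequality instance, consisting of an $m$-frequent multiset of independent nonnegative distributions together with an order in which they are revealed, such that no online algorithm is a $(0.5+\epsilon)$-approximation on it: every online algorithm has expected accepted value strictly less than $(0.5+\epsilon)\,\mathbb{E}[\max_i X_i]$.
   Context: Prophet inequality: independent nonnegative random variables $X_1,\dots,X_n$ with known distributions are revealed one by one in a fixed (here adversarially chosen) order; on seeing a value an online algorithm must irrevocably accept it (and stop) or reject it; its value is the accepted value ($0$ if none). A $\beta$-approximation achieves expected value at least $\beta\,\mathbb{E}[\max_iX_i]$. A multiset of distributions is $m$-frequent if each distribution in it appears at least $m$ times. *)

theory Defs
  imports "HOL-Probability.Probability" "HOL-Library.Multiset"
begin

definition nonneg_distribution :: "real measure \<Rightarrow> bool" where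
  "nonneg_distribution D \<longleftrightarrow>
     prob_space D \<and> sets D = sets borel \<and> (AE x in D. 0 \<le> x) \<and> integrable D (\<lambda>x. x)"

text \<open>An instance is the list of distributions in the order in which they are revealed;
  the underlying multiset of distributions is its \<open>mset\<close>.\<close>

definition prophet_instance :: "real measure list \<Rightarrow> bool" where
  "prophet_instance Ds \<longleftrightarrow> Ds \<noteq> [] \<and> (\<forall>D \<in> set Ds. nonneg_distribution D)"

definition frequent :: "nat \<Rightarrow> 'a multiset \<Rightarrow> bool" where
  "frequent m A \<longleftrightarrow> (\<forall>D \<in># A. m \<le> count A D)"

definition joint_distribution :: "real measure list \<Rightarrow> (nat \<Rightarrow> real) measure" where
  "joint_distribution Ds = (\<Pi>\<^sub>M i\<in>{..<length Ds}. Ds ! i)"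

definition expected_max :: "real measure list \<Rightarrow> real" where
  "expected_max Ds = (\<integral>x. Max (x ` {..<length Ds}) \<partial>joint_distribution Ds)"

text \<open>A (possibly randomized) online algorithm consists of a probability space \<open>R\<close>, from which
  a seed \<open>r\<close> is drawn independently of the values, and of decisions: \<open>accept i r h\<close> says whether
  the algorithm with seed \<open>r\<close>, not having stopped before, accepts the value at position \<open>i\<close>
  after having seen the history \<open>h\<close>, i.e. the values at the positions \<open>0, \<dots>, i\<close>.
  Deterministic algorithms are those that ignore \<open>r\<close>.\<close>

definition online_algorithm ::
    "nat \<Rightarrow> 'r measure \<Rightarrow> (nat \<Rightarrow> 'r \<Rightarrow> (nat \<Rightarrow> real) \<Rightarrow> bool) \<Rightarrow> bool" where
  "online_algorithm n R accept \<longleftrightarrow> prob_space R \<and>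
     (\<forall>i<n. (\<lambda>(r, h). accept i r h)
        \<in> measurable (R \<Otimes>\<^sub>M (\<Pi>\<^sub>M j\<in>{..i}. borel)) (count_space UNIV))"

definition accepts_at ::
    "(nat \<Rightarrow> 'r \<Rightarrow> (nat \<Rightarrow> real) \<Rightarrow> bool) \<Rightarrow> 'r \<Rightarrow> (nat \<Rightarrow> real) \<Rightarrow> nat \<Rightarrow> bool" where
  "accepts_at accept r x i \<longleftrightarrow> accept i r (restrict x {..i})"

definition accepted_value ::
    "nat \<Rightarrow> (nat \<Rightarrow> 'r \<Rightarrow> (nat \<Rightarrow> real) \<Rightarrow> bool) \<Rightarrow> 'r \<Rightarrow> (nat \<Rightarrow> real) \<Rightarrow> real" where
  "accepted_value n accept r x =
     (if \<exists>i<n. accepts_at accept r x i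
      then x (LEAST i. accepts_at accept r x i) else 0)"

definition expected_accepted_value ::
    "real measure list \<Rightarrow> 'r measure \<Rightarrow> (nat \<Rightarrow> 'r \<Rightarrow> (nat \<Rightarrow> real) \<Rightarrow> bool) \<Rightarrow> real" where
  "expected_accepted_value Ds R accept =
     (\<integral>(r, x). accepted_value (length Ds) accept r x \<partial>(R \<Otimes>\<^sub>M joint_distribution Ds))"

end

theory Submission
  imports Defs
begin

text \<open>Reveal \<open>m\<close> copies of the constant 1, followed by \<open>m\<close> copies of a variable that equals
  \<open>1 / t\<close> with the small probability \<open>t / m\<close> and 0 otherwise. Whether an algorithm stops among the
  constants depends on its seed alone; if it does, it gets 1, and if it does not, it gets at most
  the sum of the remaining values, whose expectation is also 1. The prophet takes a value
  \<open>1 / t\<close> if there is one, which happens with probability close to \<open>t\<close>, and otherwise takes 1, so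
  that the expected maximum tends to 2 as \<open>t\<close> tends to 0.\<close>

subsection \<open>Measure-theoretic preliminaries\<close>

lemma integrable_return:
  fixes f :: "'a \<Rightarrow> 'b :: {banach, second_countable_topology}"
  assumes [measurable]: "f \<in> borel_measurable M" and a: "a \<in> space M"
  shows "integrable (return M a) f"
proof -
  interpret prob_space "return M a" using a by (rule prob_space_return)
  show ?thesis
    using a by (intro integrable_const_bound[where B = "norm (f a)"]) (simp_all add: AE_return)
qed

lemma (in sigma_finite_measure) AE_pair_snd:
  assumes "AE x in M. P x"
  shows "AE z in N \<Otimes>\<^sub>M M. P (snd z)"
proof -
  obtain A where A: "A \<in> null_sets M" "{x \<in> space M. \<not> P x} \<subseteq> A"
    using assms by (auto elim: AE_E3 simp: eventually_ae_filter)
  show ?thesis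
  proof (rule AE_I')
    show "space N \<times> A \<in> null_sets (N \<Otimes>\<^sub>M M)" using A(1) by blast
    show "{z \<in> space (N \<Otimes>\<^sub>M M). \<not> P (snd z)} \<subseteq> space N \<times> A"
      using A(2) by (auto simp: space_pair_measure)
  qed
qed

definition two_point :: "real \<Rightarrow> real \<Rightarrow> real measure" where
  "two_point v p = distr (measure_pmf (bernoulli_pmf p)) borel (\<lambda>b. if b then v else 0)"

lemma sets_two_point [measurable_cong, simp]: "sets (two_point v p) = sets borel"
  by (simp add: two_point_def)

lemma integrable_two_point:
  fixes f :: "real \<Rightarrow> 'b :: {banach, second_countable_topology}"
  assumes [measurable]: "f \<in> borel_measurable borel"
  shows "integrable (two_point v p) f"
  unfolding two_point_def
  by (subst integrable_distr_eq) (auto intro: integrable_measure_pmf_finite)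

lemma integral_two_point:
  fixes f :: "real \<Rightarrow> real"
  assumes [measurable]: "f \<in> borel_measurable borel" and "0 \<le> p" "p \<le> 1"
  shows "(\<integral>x. f x \<partial>two_point v p) = p * f v + (1 - p) * f 0"
  unfolding two_point_def using assms by (subst integral_distr) auto

lemma measure_two_point_lessThan:
  assumes "0 < v" "0 \<le> p" "p \<le> 1"
  shows "measure (two_point v p) {..<v} = 1 - p"
  using integral_two_point[of "indicator {..<v}" p v] assms by simp

lemma nonneg_distribution_return: "0 \<le> a \<Longrightarrow> nonneg_distribution (return borel a)"
  by (simp add: nonneg_distribution_def AE_return prob_space_return integrable_return)

lemma nonneg_distribution_two_point:
  assumes "0 \<le> v"
  shows "nonneg_distribution (two_point v p)"
proof -
  have "prob_space (two_point v p)"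
    unfolding two_point_def by (intro prob_space.prob_space_distr prob_space_measure_pmf) simp
  moreover have "AE x in two_point v p. 0 \<le> x"
    unfolding two_point_def using assms by (subst AE_distr_iff) auto
  ultimately show ?thesis
    by (simp add: nonneg_distribution_def integrable_two_point)
qed

subsection \<open>The joint distribution of an instance\<close>

lemma nonneg_distribution_nth:
  "prophet_instance Ds \<Longrightarrow> i < length Ds \<Longrightarrow> nonneg_distribution (Ds ! i)"
  by (simp add: prophet_instance_def)

lemma prob_space_prophet_instance_nth:
  "prophet_instance Ds \<Longrightarrow> i < length Ds \<Longrightarrow> prob_space (Ds ! i)"
  using nonneg_distribution_nth by (auto simp: nonneg_distribution_def)

lemma sets_prophet_instance_nth:
  "prophet_instance Ds \<Longrightarrow> i < length Ds \<Longrightarrow> sets (Ds ! i) = sets borel"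
  using nonneg_distribution_nth by (auto simp: nonneg_distribution_def)

lemma space_prophet_instance_nth:
  "prophet_instance Ds \<Longrightarrow> i < length Ds \<Longrightarrow> space (Ds ! i) = UNIV"
  using sets_eq_imp_space_eq[OF sets_prophet_instance_nth] by simp

lemma prob_space_joint_distribution:
  "prophet_instance Ds \<Longrightarrow> prob_space (joint_distribution Ds)"
  unfolding joint_distribution_def by (intro prob_space_PiM prob_space_prophet_instance_nth) auto

lemma space_joint_distribution:
  assumes "prophet_instance Ds"
  shows "space (joint_distribution Ds) = (\<Pi>\<^sub>E i\<in>{..<length Ds}. UNIV)"
  unfolding joint_distribution_def space_PiM
  by (intro PiE_cong) (simp add: space_prophet_instance_nth[OF assms])

lemma AE_joint_distribution_component:
  assumes "prophet_instance Ds" "i < length Ds" "AE y in Ds ! i. P y"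
  shows "AE x in joint_distribution Ds. P (x i)"
  unfolding joint_distribution_def
  using assms by (intro AE_PiM_component[where P = P] prob_space_prophet_instance_nth) auto

lemma AE_joint_distribution_nonneg:
  assumes "prophet_instance Ds"
  shows "AE x in joint_distribution Ds. \<forall>i\<in>{..<length Ds}. 0 \<le> x i"
  using nonneg_distribution_nth[OF assms]
  by (intro AE_finite_allI AE_joint_distribution_component[OF assms, where P = "\<lambda>y. 0 \<le> y"])
    (auto simp: nonneg_distribution_def)

lemma distr_joint_distribution_component:
  assumes "prophet_instance Ds" "i < length Ds"
  shows "distr (joint_distribution Ds) (Ds ! i) (\<lambda>x. x i) = Ds ! i"
  unfolding joint_distribution_def
  using assms by (intro distr_PiM_component prob_space_prophet_instance_nth) auto

lemma measurable_joint_distribution_component: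
  assumes "i < length Ds"
  shows "(\<lambda>x. x i) \<in> joint_distribution Ds \<rightarrow>\<^sub>M Ds ! i"
  unfolding joint_distribution_def using assms by (intro measurable_component_singleton) simp

lemma borel_measurable_joint_distribution_component:
  assumes "prophet_instance Ds" "i < length Ds"
  shows "(\<lambda>x. x i) \<in> borel_measurable (joint_distribution Ds)"
  using measurable_joint_distribution_component[OF assms(2)]
  by (simp add: sets_prophet_instance_nth[OF assms] cong: measurable_cong_sets)

lemma integrable_joint_distribution_component:
  assumes "prophet_instance Ds" "i < length Ds"
  shows "integrable (joint_distribution Ds) (\<lambda>x. x i)"
proof (rule integrable_distr[OF measurable_joint_distribution_component])
  show "integrable (distr (joint_distribution Ds) (Ds ! i) (\<lambda>x. x i)) (\<lambda>y. y)"
    using nonneg_distribution_nth[OF assms]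
    by (simp add: distr_joint_distribution_component[OF assms] nonneg_distribution_def)
qed (rule assms)

lemma integral_joint_distribution_component:
  assumes "prophet_instance Ds" "i < length Ds"
  shows "(\<integral>x. x i \<partial>joint_distribution Ds) = (\<integral>y. y \<partial>(Ds ! i))"
proof -
  have "(\<lambda>y. y) \<in> borel_measurable (Ds ! i)"
    by (rule measurable_ident_sets[OF sets_prophet_instance_nth[OF assms]])
  from integral_distr[OF measurable_joint_distribution_component[OF assms(2)] this]
  show ?thesis by (simp add: distr_joint_distribution_component[OF assms])
qed

lemma nn_integral_joint_distribution_sum:
  assumes Ds: "prophet_instance Ds" and A: "A \<subseteq> {..<length Ds}"
  shows "(\<integral>\<^sup>+x. ennreal (\<Sum>i\<in>A. x i) \<partial>joint_distribution Ds)
    = ennreal (\<Sum>i\<in>A. \<integral>y. y \<partial>(Ds ! i))"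
proof -
  have int: "integrable (joint_distribution Ds) (\<lambda>x. x i)" if "i \<in> A" for i
    using A that by (intro integrable_joint_distribution_component[OF Ds]) auto
  have "(\<integral>\<^sup>+x. ennreal (\<Sum>i\<in>A. x i) \<partial>joint_distribution Ds)
    = ennreal (\<integral>x. (\<Sum>i\<in>A. x i) \<partial>joint_distribution Ds)"
  proof (rule nn_integral_eq_integral)
    show "AE x in joint_distribution Ds. 0 \<le> (\<Sum>i\<in>A. x i)"
      using AE_joint_distribution_nonneg[OF Ds]
      by eventually_elim (use A in \<open>auto intro: sum_nonneg\<close>)
  qed (intro Bochner_Integration.integrable_sum int)
  also have "(\<integral>x. (\<Sum>i\<in>A. x i) \<partial>joint_distribution Ds)
    = (\<Sum>i\<in>A. \<integral>x. x i \<partial>joint_distribution Ds)"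
    by (intro Bochner_Integration.integral_sum int)
  also have "\<dots> = (\<Sum>i\<in>A. \<integral>y. y \<partial>(Ds ! i))"
    using A by (intro sum.cong integral_joint_distribution_component[OF Ds]) auto
  finally show ?thesis .
qed

lemma sets_joint_distribution_PiE:
  assumes Ds: "prophet_instance Ds" and A: "\<And>i. i < length Ds \<Longrightarrow> A i \<in> sets borel"
  shows "(\<Pi>\<^sub>E i\<in>{..<length Ds}. A i) \<in> sets (joint_distribution Ds)"
  unfolding joint_distribution_def using A sets_prophet_instance_nth[OF Ds]
  by (intro sets_PiM_I_finite) auto

lemma measure_joint_distribution_PiE:
  assumes Ds: "prophet_instance Ds" and A: "\<And>i. i < length Ds \<Longrightarrow> A i \<in> sets borel"
  shows "measure (joint_distribution Ds) (\<Pi>\<^sub>E i\<in>{..<length Ds}. A i)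
    = (\<Prod>i<length Ds. measure (Ds ! i) (A i))"
proof -
  let ?I = "{..<length Ds}"
  have "prod_emb ?I (\<lambda>i. Ds ! i) ?I (\<Pi>\<^sub>E i\<in>?I. A i) = (\<Pi>\<^sub>E i\<in>?I. A i)"
    by (intro prod_emb_PiE_same_index) (simp add: space_prophet_instance_nth[OF Ds])
  then have "emeasure (joint_distribution Ds) (\<Pi>\<^sub>E i\<in>?I. A i)
      = (\<Prod>i\<in>?I. emeasure (Ds ! i) (A i))"
    unfolding joint_distribution_def
    using emeasure_PiM_emb[of ?I "\<lambda>i. Ds ! i" ?I A]
      prob_space_prophet_instance_nth[OF Ds] sets_prophet_instance_nth[OF Ds] A
    by simp
  also have "\<dots> = (\<Prod>i\<in>?I. ennreal (measure (Ds ! i) (A i)))"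
    using prob_space_prophet_instance_nth[OF Ds]
    by (intro prod.cong refl finite_measure.emeasure_eq_measure)
      (auto simp: prob_space_def)
  finally show ?thesis
    by (simp add: measure_def prod_ennreal prod_nonneg)
qed

subsection \<open>A lower bound for the prophet\<close>

lemma integrable_Max_joint_distribution:
  assumes "prophet_instance Ds"
  shows "integrable (joint_distribution Ds) (\<lambda>x. Max (x ` {..<length Ds}))"
  using assms
  by (intro integrable_MAX integrable_joint_distribution_component)
    (auto simp: prophet_instance_def)

lemma AE_joint_distribution_Max_ge:
  assumes Ds: "prophet_instance Ds" and D: "D \<in> set Ds" "AE y in D. c \<le> y"
  shows "AE x in joint_distribution Ds.
    v - (v - c) * indicator (\<Pi>\<^sub>E i\<in>{..<length Ds}. {..<v}) x \<le> Max (x ` {..<length Ds})"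
proof -
  let ?I = "{..<length Ds}"
  obtain i where i: "i < length Ds" "Ds ! i = D" using D(1) by (auto simp: in_set_conv_nth)
  have "AE x in joint_distribution Ds. c \<le> x i"
    using i D(2) by (intro AE_joint_distribution_component[OF Ds]) auto
  then show ?thesis
    using AE_space
  proof eventually_elim
    case (elim x)
    have le_Max: "x j \<le> Max (x ` ?I)" if "j < length Ds" for j
      using that by (intro Max_ge) auto
    show ?case
    proof (cases "x \<in> (\<Pi>\<^sub>E i\<in>?I. {..<v})")
      case True
      with elim(1) le_Max[OF i(1)] show ?thesis by simp
    next
      case False
      then obtain j where "j < length Ds" "v \<le> x j"
        using elim(2) by (auto simp: space_joint_distribution[OF Ds] PiE_iff not_less)
      with le_Max[of j] have "v \<le> Max (x ` ?I)" by linarith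
      with False show ?thesis by simp
    qed
  qed
qed

lemma expected_max_ge:
  assumes Ds: "prophet_instance Ds" and D: "D \<in> set Ds" "AE y in D. c \<le> y"
  shows "c + (v - c) * (1 - (\<Prod>D\<leftarrow>Ds. measure D {..<v})) \<le> expected_max Ds"
proof -
  let ?J = "joint_distribution Ds"
  interpret J: prob_space ?J using Ds by (rule prob_space_joint_distribution)
  define B where "B = (\<Pi>\<^sub>E i\<in>{..<length Ds}. {..<v})"
  have B: "B \<in> sets ?J"
    unfolding B_def by (rule sets_joint_distribution_PiE[OF Ds]) simp
  have prob_B: "measure ?J B = (\<Prod>D\<leftarrow>Ds. measure D {..<v})"
    unfolding B_def using measure_joint_distribution_PiE[OF Ds, of "\<lambda>_. {..<v}"]
    by (simp add: prod.list_conv_set_nth lessThan_atLeast0)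
  have integrable: "integrable ?J (\<lambda>x. v - (v - c) * indicator B x)"
    using B by (simp add: J.emeasure_eq_measure)
  have "c + (v - c) * (1 - measure ?J B) = v - (v - c) * measure ?J B"
    by (simp add: algebra_simps)
  also have "\<dots> = (\<integral>x. v - (v - c) * indicator B x \<partial>?J)"
    using B by (simp add: J.prob_space J.emeasure_eq_measure)
  also have "\<dots> \<le> (\<integral>x. Max (x ` {..<length Ds}) \<partial>?J)"
    using integrable integrable_Max_joint_distribution[OF Ds]
      AE_joint_distribution_Max_ge[OF Ds D, of v, folded B_def]
    by (rule integral_mono_AE)
  finally show ?thesis by (simp add: prob_B expected_max_def)
qed

subsection \<open>Online algorithms facing an almost surely constant prefix\<close>

definition stops_before ::
    "nat \<Rightarrow> (nat \<Rightarrow> 'r \<Rightarrow> (nat \<Rightarrow> real) \<Rightarrow> bool) \<Rightarrow> 'r \<Rightarrow> (nat \<Rightarrow> real) \<Rightarrow> bool" where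
  "stops_before k accept r x \<longleftrightarrow> (\<exists>i<k. accepts_at accept r x i)"

lemma stops_before_cong:
  assumes "\<And>i. i < k \<Longrightarrow> x i = y i"
  shows "stops_before k accept r x = stops_before k accept r y"
proof -
  have "restrict x {..i} = restrict y {..i}" if "i < k" for i
    using that assms by (intro restrict_ext) auto
  then show ?thesis by (auto simp: stops_before_def accepts_at_def)
qed

lemma pred_stops_before:
  assumes "online_algorithm n R accept" "k \<le> n"
  shows "Measurable.pred R (\<lambda>r. stops_before k accept r x)"
proof -
  have "Measurable.pred R (\<lambda>r. accepts_at accept r x i)" if "i < k" for i
  proof -
    have "(\<lambda>r. (r, restrict x {..i})) \<in> R \<rightarrow>\<^sub>M R \<Otimes>\<^sub>M (\<Pi>\<^sub>M j\<in>{..i}. (borel :: real measure))"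
      by (intro measurable_Pair measurable_ident_sets refl measurable_const)
        (auto simp: space_PiM)
    moreover have "(\<lambda>(r, h). accept i r h) \<in> R \<Otimes>\<^sub>M (\<Pi>\<^sub>M j\<in>{..i}. borel) \<rightarrow>\<^sub>M count_space UNIV"
      using assms that by (simp add: online_algorithm_def)
    ultimately have "(\<lambda>r. case (r, restrict x {..i}) of (r, h) \<Rightarrow> accept i r h)
        \<in> R \<rightarrow>\<^sub>M count_space UNIV"
      by (rule measurable_compose)
    then show ?thesis unfolding accepts_at_def prod.case .
  qed
  then have "Measurable.pred R (\<lambda>r. \<exists>i\<in>{..<k}. accepts_at accept r x i)"
    by (intro pred_intros_finite) auto
  then show ?thesis by (simp only: stops_before_def Bex_def lessThan_iff)
qed

lemma accepted_value_le:
  assumes "k \<le> n" and prefix: "\<And>i. i < k \<Longrightarrow> x i \<le> b"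
    and nonneg: "\<And>i. i \<in> {k..<n} \<Longrightarrow> 0 \<le> x i"
  shows "accepted_value n accept r x
    \<le> (if stops_before k accept r x then b else \<Sum>i=k..<n. x i)"
proof (cases "stops_before n accept r x")
  case False
  then show ?thesis
    using assms by (auto simp: accepted_value_def stops_before_def intro!: sum_nonneg)
next
  case True
  define L where "L = (LEAST i. accepts_at accept r x i)"
  have L_le: "L \<le> i" if "accepts_at accept r x i" for i
    unfolding L_def using that by (rule Least_le)
  obtain i where i: "i < n" "accepts_at accept r x i"
    using True by (auto simp: stops_before_def)
  then have L: "accepts_at accept r x L" unfolding L_def by (intro LeastI)
  have "L < n" using L_le[OF i(2)] i(1) by (rule le_less_trans)
  have val: "accepted_value n accept r x = x L"
    using True by (simp add: accepted_value_def stops_before_def L_def)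
  show ?thesis
  proof (cases "stops_before k accept r x")
    case True
    then have "L < k" using L_le by (fastforce simp: stops_before_def)
    then show ?thesis using val prefix True by simp
  next
    case False
    then have "L \<in> {k..<n}"
      using L \<open>L < n\<close> by (auto simp: stops_before_def not_less)
    then have "x L \<le> (\<Sum>i=k..<n. x i)"
      by (intro member_le_sum) (auto intro: nonneg)
    then show ?thesis using val False by simp
  qed
qed

lemma AE_accepted_value_le_of_constant_prefix:
  assumes Ds: "prophet_instance Ds" and k: "k \<le> length Ds"
    and prefix: "\<And>i. i < k \<Longrightarrow> AE y in Ds ! i. y = c i"
    and c: "\<And>i. i < k \<Longrightarrow> c i \<le> b"
  shows "AE x in joint_distribution Ds. \<forall>r. accepted_value (length Ds) accept r x
    \<le> (if stops_before k accept r c then b else \<Sum>i=k..<length Ds. x i)"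
proof -
  have "AE x in joint_distribution Ds. \<forall>i\<in>{..<k}. x i = c i"
    using k prefix
    by (intro AE_finite_allI AE_joint_distribution_component[OF Ds, where P = "\<lambda>y. y = c _"]) auto
  then show ?thesis
    using AE_joint_distribution_nonneg[OF Ds]
  proof eventually_elim
    case (elim x)
    then have "stops_before k accept r c = stops_before k accept r x" for r
      by (intro stops_before_cong) simp
    then show ?case
      using elim k c accepted_value_le[of k "length Ds" x b accept] by simp
  qed
qed

lemma nn_integral_accepted_value_le_of_constant_prefix:
  assumes Ds: "prophet_instance Ds" and alg: "online_algorithm (length Ds) R accept"
    and k: "k \<le> length Ds"
    and prefix: "\<And>i. i < k \<Longrightarrow> AE y in Ds ! i. y = c i"
    and c: "\<And>i. i < k \<Longrightarrow> c i \<le> b"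
    and suffix: "(\<Sum>i=k..<length Ds. \<integral>y. y \<partial>(Ds ! i)) \<le> b"
  shows "(\<integral>\<^sup>+(r, x). ennreal (accepted_value (length Ds) accept r x)
      \<partial>(R \<Otimes>\<^sub>M joint_distribution Ds)) \<le> ennreal b"
proof -
  let ?J = "joint_distribution Ds" and ?n = "length Ds"
  define g :: "'a \<times> (nat \<Rightarrow> real) \<Rightarrow> real" where
    "g = (\<lambda>(r, x). if stops_before k accept r c then b else \<Sum>i=k..<?n. x i)"
  interpret R: prob_space R using alg by (simp add: online_algorithm_def)
  interpret J: prob_space ?J using Ds by (rule prob_space_joint_distribution)
  note [measurable] = pred_stops_before[OF alg k]
  have [measurable]: "(\<lambda>x. \<Sum>i=k..<?n. x i) \<in> borel_measurable ?J"
    by (intro borel_measurable_sum borel_measurable_joint_distribution_component[OF Ds]) simp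
  have [measurable]: "g \<in> borel_measurable (R \<Otimes>\<^sub>M ?J)"
    unfolding g_def by measurable
  have "AE x in ?J. \<forall>r. accepted_value ?n accept r x \<le> g (r, x)"
    unfolding g_def prod.case by (rule AE_accepted_value_le_of_constant_prefix[OF Ds k prefix c])
  then have "AE z in R \<Otimes>\<^sub>M ?J. (\<lambda>(r, x). ennreal (accepted_value ?n accept r x)) z \<le> ennreal (g z)"
    by (auto dest!: J.AE_pair_snd[of _ R] elim!: eventually_mono intro: ennreal_leI)
  then have "(\<integral>\<^sup>+(r, x). ennreal (accepted_value ?n accept r x) \<partial>(R \<Otimes>\<^sub>M ?J))
      \<le> (\<integral>\<^sup>+z. ennreal (g z) \<partial>(R \<Otimes>\<^sub>M ?J))"
    by (rule nn_integral_mono_AE)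
  also have "\<dots> = (\<integral>\<^sup>+r. \<integral>\<^sup>+x. ennreal (g (r, x)) \<partial>?J \<partial>R)"
    by (rule J.nn_integral_fst[symmetric]) measurable
  also have "\<dots> \<le> (\<integral>\<^sup>+r. ennreal b \<partial>R)"
  proof (rule nn_integral_mono)
    fix r
    show "(\<integral>\<^sup>+x. ennreal (g (r, x)) \<partial>?J) \<le> ennreal b"
      using nn_integral_joint_distribution_sum[OF Ds, of "{k..<?n}"] suffix
      by (cases "stops_before k accept r c")
        (auto simp: g_def J.emeasure_space_1 subset_eq intro: ennreal_leI)
  qed
  also have "\<dots> = ennreal b" by (simp add: R.emeasure_space_1)
  finally show ?thesis .
qed

lemma expected_accepted_value_le_of_constant_prefix:
  assumes Ds: "prophet_instance Ds" and alg: "online_algorithm (length Ds) R accept"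
    and k: "k \<le> length Ds"
    and prefix: "\<And>i. i < k \<Longrightarrow> AE y in Ds ! i. y = c i"
    and c: "\<And>i. i < k \<Longrightarrow> c i \<le> b"
    and suffix: "(\<Sum>i=k..<length Ds. \<integral>y. y \<partial>(Ds ! i)) \<le> b"
  shows "expected_accepted_value Ds R accept \<le> b"
  unfolding expected_accepted_value_def
  \<comment> \<open>This rule does not ask for integrability: the integral of a non-integrable function is 0.\<close>
proof (rule integral_real_bounded)
  have "0 \<le> (\<Sum>i=k..<length Ds. \<integral>y. y \<partial>(Ds ! i))"
    using nonneg_distribution_nth[OF Ds]
    by (intro sum_nonneg integral_nonneg_AE) (auto simp: nonneg_distribution_def)
  also have "\<dots> \<le> b" by (rule suffix)
  finally show "0 \<le> b" .
  show "(\<integral>\<^sup>+z. ennreal (case z of (r, x) \<Rightarrow> accepted_value (length Ds) accept r x)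
      \<partial>(R \<Otimes>\<^sub>M joint_distribution Ds)) \<le> ennreal b"
    using nn_integral_accepted_value_le_of_constant_prefix[OF Ds alg k prefix c suffix]
    by (simp add: case_prod_unfold)
qed

subsection \<open>The hard instance\<close>

definition hard_instance :: "nat \<Rightarrow> real \<Rightarrow> real measure list" where
  "hard_instance m t = replicate m (return borel 1) @ replicate m (two_point (1 / t) (t / m))"

lemma nth_hard_instance:
  "i < 2 * m \<Longrightarrow> hard_instance m t ! i
    = (if i < m then return borel 1 else two_point (1 / t) (t / m))"
  by (simp add: hard_instance_def nth_append)

lemma length_hard_instance [simp]: "length (hard_instance m t) = 2 * m"
  by (simp add: hard_instance_def)

lemma frequent_hard_instance: "frequent m (mset (hard_instance m t))"
  by (auto simp: frequent_def hard_instance_def)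

lemma prophet_instance_hard_instance:
  assumes "m \<ge> 1" "t \<ge> 0"
  shows "prophet_instance (hard_instance m t)"
  using assms nonneg_distribution_return[of 1] nonneg_distribution_two_point[of "1 / t"]
  by (auto simp: prophet_instance_def hard_instance_def)

lemma expected_max_hard_instance_ge:
  assumes "m \<ge> 1" "0 < t" "t < 1"
  shows "1 + (1 / t - 1) * (1 - (1 - t / m) ^ m) \<le> expected_max (hard_instance m t)"
proof -
  have "t / m \<le> 1" using assms by (simp add: divide_le_eq)
  then have "(\<Prod>D\<leftarrow>hard_instance m t. measure D {..<1 / t}) = (1 - t / m) ^ m"
    using assms by (simp add: hard_instance_def measure_two_point_lessThan measure_return)
  moreover have "return borel 1 \<in> set (hard_instance m t)"
    using assms by (simp add: hard_instance_def)
  ultimately show ?thesis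
    using assms
      expected_max_ge[OF prophet_instance_hard_instance, of m t "return borel 1" 1 "1 / t"]
    by (simp add: AE_return)
qed

lemma expected_accepted_value_hard_instance_le:
  assumes t: "0 < t" "t \<le> real m"
    and alg: "online_algorithm (2 * m) R accept"
  shows "expected_accepted_value (hard_instance m t) R accept \<le> 1"
proof (rule expected_accepted_value_le_of_constant_prefix[where k = m and c = "\<lambda>_. 1"])
  have "m \<ge> 1" using t by (cases m) auto
  then show "prophet_instance (hard_instance m t)"
    using t(1) by (intro prophet_instance_hard_instance) auto
  show "online_algorithm (length (hard_instance m t)) R accept" using alg by simp
  show "AE y in hard_instance m t ! i. y = 1" if "i < m" for i
    using that by (subst nth_hard_instance) (auto simp: AE_return)
  have "t / m \<le> 1" using t by (simp add: divide_le_eq)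
  then have "(\<integral>y. y \<partial>(hard_instance m t ! i)) = 1 / m" if "i \<in> {m..<2 * m}" for i
    using that t integral_two_point[of "\<lambda>y. y" "t / m" "1 / t"]
    by (simp add: nth_hard_instance)
  then show "(\<Sum>i=m..<length (hard_instance m t). \<integral>y. y \<partial>(hard_instance m t ! i)) \<le> 1"
    by simp
qed simp_all

lemma expected_max_hard_instance_bound_tendsto:
  assumes "m \<ge> 1"
  shows "((\<lambda>t. 1 + (1 / t - 1) * (1 - (1 - t / real m) ^ m)) \<longlongrightarrow> 2) (at_right 0)"
proof -
  define q where "q t = (1 - t / real m) ^ m" for t
  have "(q has_real_derivative - 1) (at 0)"
    unfolding q_def using assms by (auto intro!: derivative_eq_intros)
  then have "((\<lambda>t. (q t - 1) / t) \<longlongrightarrow> - 1) (at_right 0)"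
    by (simp add: has_field_derivative_iff q_def filterlim_at_split)
  moreover have "(q \<longlongrightarrow> 1) (at_right 0)"
    unfolding q_def using assms by (auto intro!: tendsto_eq_intros)
  ultimately have "((\<lambda>t. 1 - (q t - 1) / t - (1 - q t)) \<longlongrightarrow> 1 - (- 1) - (1 - 1)) (at_right 0)"
    by (intro tendsto_intros)
  then show ?thesis
    by (simp add: q_def algebra_simps diff_divide_distrib)
qed

lemma expected_max_hard_instance_gt:
  assumes "m \<ge> 1" "a < 2"
  obtains t where "0 < t" "t < 1" "a < expected_max (hard_instance m t)"
proof -
  have "\<forall>\<^sub>F t in at_right 0. a < 1 + (1 / t - 1) * (1 - (1 - t / real m) ^ m)"
    using expected_max_hard_instance_bound_tendsto[OF assms(1)] assms(2) by (rule order_tendstoD)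
  moreover have "\<forall>\<^sub>F t in at_right 0. t \<in> {0<..<1::real}"
    by (rule eventually_at_right_real) simp
  ultimately have "\<forall>\<^sub>F t in at_right 0. 0 < t \<and> t < 1 \<and> a < expected_max (hard_instance m t)"
    by eventually_elim (use expected_max_hard_instance_ge[OF assms(1)] in force)
  then show ?thesis
    using that by (auto dest!: eventually_happens)
qed

theorem theorem4:
  fixes m :: nat and \<epsilon> :: real
  assumes "m \<ge> 1" and "\<epsilon> > 0"
  shows "\<exists>Ds :: real measure list.
           prophet_instance Ds \<and> frequent m (mset Ds) \<and>
           (\<forall>(R :: real measure) accept. online_algorithm (length Ds) R accept \<longrightarrow>
              expected_accepted_value Ds R accept < (1/2 + \<epsilon>) * expected_max Ds)"
proof -
  have "1 / (1/2 + \<epsilon>) < 2" using assms(2) by (simp add: field_simps)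
  then obtain t where t: "0 < t" "t < 1" "1 / (1/2 + \<epsilon>) < expected_max (hard_instance m t)"
    by (rule expected_max_hard_instance_gt[OF assms(1)])
  have "t \<le> real m" using t(2) assms(1) by linarith
  have "expected_accepted_value (hard_instance m t) R accept
      < (1/2 + \<epsilon>) * expected_max (hard_instance m t)"
    if "online_algorithm (2 * m) R accept" for R :: "real measure" and accept
  proof -
    have "expected_accepted_value (hard_instance m t) R accept \<le> 1"
      by (rule expected_accepted_value_hard_instance_le[OF t(1) \<open>t \<le> real m\<close> that])
    also have "1 < (1/2 + \<epsilon>) * expected_max (hard_instance m t)"
      using t(3) assms(2) by (simp add: pos_divide_less_eq mult.commute)
    finally show ?thesis .
  qed
  then show ?thesis
    using prophet_instance_hard_instance[of m t] frequent_hard_instance assms(1) t(1)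
    by (intro exI[of _ "hard_instance m t"]) auto
qed

end
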